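(* Let $n\ge p$ and let $U,\tilde U\in St(n,p)$. Assume that $\tilde U$ lies in a neighborhood $\mathcal D$ of $U$ such that $Exp^{St}_U$ is a diffeomorphism from a neighborhood of $0\in T_USt(n,p)$ onto $\mathcal D$, and let $Log^{St}_U$ denote its inverse. Set $M:=U^T\tilde U\in\mathbb R^{p\times p}$, let $QN=(I-UU^T)\tilde U$ be a thin QR decomposition with $Q\in St(n,p)$, $N\in\mathbb R^{p\times p}$, and let $X_0,Y_0\in\mathbb R^{p\times p}$ be such that $\begin{pmatrix}M&X_0\\ N&Y_0\end{pmatrix}$ is an orthogonal $2p\times 2p$ matrix. Suppose $\Phi\in O_{p\times p}$ satisfies \[\log_m\begin{pmatrix}M & X_0\Phi\\ N & Y_0\Phi\end{pmatrix}=\begin{pmatrix}A & -B^T\\ B & 0\end{pmatrix}\] for some $A,B\in\mathbb R^{p\times p}$. Define $\Delta:=UA+QB$. Then $\Delta\in T_USt(n,p)$, $Exp^{St}_U(\Delta)=\tilde U$, i.e. $\Delta=Log^{St}_U(\tilde U)$.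
   Context: $St(n,p)=\{U\in\mathbb R^{n\times p}: U^TU=I_p\}$ is the Stiefel manifold, with tangent space $T_USt(n,p)=\{\Delta\in\mathbb R^{n\times p}: U^T\Delta=-\Delta^TU\}$ and the canonical metric $\langle\Delta,\tilde\Delta\rangle_U=\mathrm{tr}(\Delta^T(I-\tfrac12UU^T)\tilde\Delta)$. $O_{p\times p}$ is the group of real orthogonal $p\times p$ matrices. $\exp_m$ is the matrix exponential and $\log_m$ the principal matrix logarithm. $Exp^{St}_U$ is the Riemannian exponential of $St(n,p)$ at $U$ for the canonical metric, given explicitly by: for $\Delta\in T_USt(n,p)$, let $A=U^T\Delta$ (skew-symmetric), let $Q_ER_E=(I-UU^T)\Delta$ be a thin QR decomposition, let $\begin{pmatrix}M_E\\ N_E\end{pmatrix}=\exp_m\begin{pmatrix}A&-R_E^T\\ R_E&0\end{pmatrix}\begin{pmatrix}I_p\\0\end{pmatrix}$; then $Exp^{St}_U(\Delta)=UM_E+Q_EN_E$. *)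

theory Defs
  imports "HOL-Analysis.Analysis"
begin

definition stiefel :: "(real^'p^'n) set" where
  "stiefel = {U. transpose U ** U = mat 1}"

definition tangent_stiefel :: "real^'p^'n \<Rightarrow> (real^'p^'n) set" where
  "tangent_stiefel U = {D. transpose U ** D = - (transpose D ** U)}"

definition orthogonal_mat :: "real^'m^'m \<Rightarrow> bool" where
  "orthogonal_mat Q \<longleftrightarrow> transpose Q ** Q = mat 1 \<and> Q ** transpose Q = mat 1"

definition upper_triangular :: "((real, 'p::{finite,linorder}) vec, 'p) vec \<Rightarrow> bool" where
  "upper_triangular R \<longleftrightarrow> (\<forall>i j. j < i \<longrightarrow> R $ i $ j = 0)"

definition thin_qr :: "((real, 'p::{finite,linorder}) vec, 'n::finite) vec \<Rightarrow> ((real, 'p) vec, 'n) vec \<Rightarrow> ((real, 'p) vec, 'p) vec \<Rightarrow> bool" where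
  "thin_qr W Q R \<longleftrightarrow> Q \<in> stiefel \<and> upper_triangular R \<and> Q ** R = W"

primrec matpow :: "real^'m^'m \<Rightarrow> nat \<Rightarrow> real^'m^'m" where
  "matpow A 0 = mat 1"
| "matpow A (Suc k) = A ** matpow A k"

definition mexp :: "real^'m^'m \<Rightarrow> real^'m^'m" where
  "mexp A = (\<Sum>k. (1 / fact k) *\<^sub>R matpow A k)"

definition is_eigenvalue :: "real^'m^'m \<Rightarrow> complex \<Rightarrow> bool" where
  "is_eigenvalue L \<mu> \<longleftrightarrow>
     det (\<chi> i j. (if i = j then \<mu> else 0) - complex_of_real (L $ i $ j)) = 0"

text \<open>L is the principal logarithm of X: exp(L) = X and every eigenvalue of L has
  imaginary part in the open interval (-pi, pi). (Such an L is unique when it exists.)\<close>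
definition principal_log :: "real^'m^'m \<Rightarrow> real^'m^'m \<Rightarrow> bool" where
  "principal_log X L \<longleftrightarrow> mexp L = X \<and>
     (\<forall>\<mu>. is_eigenvalue L \<mu> \<longrightarrow> - pi < Im \<mu> \<and> Im \<mu> < pi)"

definition block :: "real^'p^'p \<Rightarrow> real^'p^'p \<Rightarrow> real^'p^'p \<Rightarrow> real^'p^'p
                     \<Rightarrow> real^('p+'p)^('p+'p)" where
  "block P X N Y = (\<chi> i j. case i of
       Inl a \<Rightarrow> (case j of Inl b \<Rightarrow> P $ a $ b | Inr b \<Rightarrow> X $ a $ b)
     | Inr a \<Rightarrow> (case j of Inl b \<Rightarrow> N $ a $ b | Inr b \<Rightarrow> Y $ a $ b))"

definition stack_id_zero :: "real^'p^('p+'p)" where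
  "stack_id_zero = (\<chi> i j. case i of Inl a \<Rightarrow> (if a = j then 1 else 0) | Inr a \<Rightarrow> 0)"

definition top_block :: "real^'p^('p+'p) \<Rightarrow> real^'p^'p" where
  "top_block W = (\<chi> a b. W $ Inl a $ b)"

definition bottom_block :: "real^'p^('p+'p) \<Rightarrow> real^'p^'p" where
  "bottom_block W = (\<chi> a b. W $ Inr a $ b)"

section \<open>Riemannian exponential of St(n,p), canonical metric\<close>

definition stiefel_exp :: "((real, 'p::{finite,linorder}) vec, 'n::finite) vec \<Rightarrow> ((real, 'p) vec, 'n) vec \<Rightarrow> ((real, 'p) vec, 'n) vec"
  where "stiefel_exp U D =
    (let A = transpose U ** D;
         W = (mat 1 - U ** transpose U) ** D;
         QR = (SOME QR. thin_qr W (fst QR) (snd QR));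
         QE = fst QR; RE = snd QR;
         E = mexp (block A (- transpose RE) RE 0) ** stack_id_zero
     in U ** top_block E + QE ** bottom_block E)"

end

theory Submission
  imports Defs
begin

text \<open>
  Write \<open>L\<close> for the given principal logarithm and \<open>V = exp L\<close>, an orthogonal matrix. Two facts
  about \<open>L\<close> carry the proof.

  First, \<open>L\<close> is skew. As \<open>V\<close> is orthogonal, \<open>F(t)\<^sup>T F(t)\<close> with \<open>F(t) = exp (t L)\<close> is
  1-periodic, and averaging it gives an inner product \<open>G\<close> for which \<open>L\<close> is skew. By the condition on the
  spectrum, \<open>L\<close> has \<open>G\<close>-norm below \<open>\<pi>\<close>, so whatever commutes with \<open>V\<close> commutes with \<open>L\<close>;
  this applies to \<open>G\<close>, and \<open>L\<close> is skew for the standard inner product too.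

  Second, \<open>N\<^sup>T w = 0\<close> implies \<open>B\<^sup>T w = 0\<close>. Since \<open>U\<^sup>T Q N = 0\<close>, this gives
  \<open>U\<^sup>T Q B = 0\<close>, although \<open>U\<^sup>T Q\<close> itself need not vanish when \<open>N\<close> is singular. Hence
  \<open>U\<^sup>T \<Delta> = A\<close> and \<open>(I - U U\<^sup>T) \<Delta> = Q B\<close>, and \<open>Q\<close>, \<open>B\<close> can be used in place of the QR
  factors in the Riemannian exponential.

  Both facts rest on one estimate: a trajectory of \<open>u' = A u\<close> with \<open>A\<close> skew of norm at most
  \<open>\<omega>\<close> turns by an angle of at most \<open>\<omega> t\<close> in time \<open>t\<close>.
\<close>

section \<open>Matrices and the matrix exponential\<close>

lemma bounded_bilinear_matrix_matrix_mult:
  "bounded_bilinear (matrix_matrix_mult :: real^'b^'a \<Rightarrow> real^'c^'b \<Rightarrow> real^'c^'a)"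
  unfolding bilinear_conv_bounded_bilinear[symmetric] bilinear_def
  by (auto intro!: linearI simp: matrix_add_ldistrib matrix_scalar_ac scalar_matrix_assoc
      matrix_matrix_mult_def vec_eq_iff sum.distrib distrib_right distrib_left sum_distrib_left
      mult_ac)

interpretation matmul: bounded_bilinear "matrix_matrix_mult :: real^'b^'a \<Rightarrow> real^'c^'b \<Rightarrow> real^'c^'a"
  by (rule bounded_bilinear_matrix_matrix_mult)

lemma bounded_linear_matrix_transpose: "bounded_linear (transpose :: real^'n^'m \<Rightarrow> real^'m^'n)"
  unfolding linear_conv_bounded_linear[symmetric]
  by (auto intro!: linearI simp: transpose_def vec_eq_iff)

lemma transpose_add: "transpose (A + B) = transpose A + transpose (B :: real^'n^'m)"
  and transpose_minus: "transpose (- A) = - transpose (A :: real^'n^'m)"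
  by (auto simp: transpose_def vec_eq_iff)

lemma minus_matrix_vector_mult: "(- A) *v x = - (A *v (x :: real^'n))"
  and matrix_vector_mult_minus: "A *v (- x) = - (A *v (x :: real^'n))"
  by (simp_all add: matrix_vector_mult_def vec_eq_iff sum_negf)

lemma inner_matrix_vector_mult: "x \<bullet> (A *v y) = (transpose A *v x) \<bullet> (y :: real^'n)"
  by (simp add: dot_lmul_matrix[symmetric] vector_transpose_matrix)

lemma inner_matrix_vector_mult_left: "(A *v y) \<bullet> x = y \<bullet> (transpose A *v (x :: real^'n))"
  by (metis inner_matrix_vector_mult inner_commute)

lemma inner_matrix_matrix_mult:
  "X \<bullet> (A ** Y) = (transpose A ** X) \<bullet> (Y :: real^'c^'b)" for A :: "real^'b^'a"
proof -
  have "X \<bullet> (A ** Y) = (\<Sum>i\<in>UNIV. \<Sum>j\<in>UNIV. \<Sum>k\<in>UNIV. X$i$j * A$i$k * Y$k$j)"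
    by (simp add: inner_vec_def matrix_matrix_mult_def sum_distrib_left mult_ac)
  also have "\<dots> = (\<Sum>i\<in>UNIV. \<Sum>k\<in>UNIV. \<Sum>j\<in>UNIV. X$i$j * A$i$k * Y$k$j)"
    by (rule sum.cong[OF refl], rule sum.swap)
  also have "\<dots> = (\<Sum>k\<in>UNIV. \<Sum>i\<in>UNIV. \<Sum>j\<in>UNIV. X$i$j * A$i$k * Y$k$j)"
    by (rule sum.swap)
  also have "\<dots> = (\<Sum>k\<in>UNIV. \<Sum>j\<in>UNIV. \<Sum>i\<in>UNIV. X$i$j * A$i$k * Y$k$j)"
    by (rule sum.cong[OF refl], rule sum.swap)
  also have "\<dots> = (transpose A ** X) \<bullet> Y"
    by (simp add: inner_vec_def matrix_matrix_mult_def transpose_def sum_distrib_left mult_ac)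
  finally show ?thesis .
qed

lemma inner_transpose: "transpose X \<bullet> transpose Y = X \<bullet> (Y :: real^'n^'m)"
  unfolding inner_vec_def transpose_def by (simp, rule sum.swap)

lemma norm_transpose: "norm (transpose X) = norm (X :: real^'n^'m)"
  by (simp add: norm_eq_sqrt_inner inner_transpose)

text \<open>The norm of a matrix is the Frobenius norm, so its square is the sum of the squared
  norms of the columns, and an operator bound for \<open>A\<close> can be applied column by column.
  This later bounds commutation with \<open>K\<close> as an operator on matrices.\<close>

lemma norm_matrix_mult_le:
  fixes A :: "real^'b^'a" and X :: "real^'c^'b"
  assumes "\<And>x. norm (A *v x) \<le> k * norm x"
  shows "norm (A ** X) \<le> k * norm X"
proof -
  have sq: "(norm M)\<^sup>2 = (\<Sum>j\<in>UNIV. (norm (column j M))\<^sup>2)" for M :: "real^'c^'d"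
    unfolding power2_norm_eq_inner inner_vec_def column_def by (simp, rule sum.swap)
  have k: "k \<ge> 0"
    using order_trans[OF norm_ge_zero assms[of "axis undefined 1"]] by (simp add: norm_axis_1)
  have "(norm (A ** X))\<^sup>2 = (\<Sum>j\<in>UNIV. (norm (A *v column j X))\<^sup>2)"
    by (subst sq) (simp add: column_def matrix_matrix_mult_def matrix_vector_mult_def)
  also have "\<dots> \<le> (\<Sum>j\<in>UNIV. (k * norm (column j X))\<^sup>2)"
    by (intro sum_mono power_mono assms) auto
  also have "\<dots> = (k * norm X)\<^sup>2"
    by (simp add: power_mult_distrib sq[of X] sum_distrib_left)
  finally show ?thesis
    by (rule power2_le_imp_le) (simp add: k)
qed

section \<open>Convergence, derivative and group law of the matrix exponential\<close>

lemma matpow_scaleR: "matpow (t *\<^sub>R L) k = t ^ k *\<^sub>R matpow L k"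
  by (induction k) (auto simp: matmul.scaleR_left matmul.scaleR_right mult.commute)

lemma matpow_commute: "matpow L k ** L = L ** matpow L k"
  by (induction k) (auto simp: matrix_mul_assoc[symmetric])

lemma summable_matpow: "summable (\<lambda>k. (1 / fact k) *\<^sub>R matpow (L :: real^'m^'m) k)"
proof -
  obtain K where K: "K > 0" "\<And>(A :: real^'m^'m) (B :: real^'m^'m). norm (A ** B) \<le> norm A * norm B * K"
    using matmul.pos_bounded by blast
  have bound: "norm (matpow L k) \<le> norm (mat 1 :: real^'m^'m) * (norm L * K) ^ k" for k
  proof (induction k)
    case (Suc k)
    have "norm (matpow L (Suc k)) \<le> norm L * norm (matpow L k) * K"
      using K(2) by simp
    also have "\<dots> \<le> norm L * (norm (mat 1 :: real^'m^'m) * (norm L * K) ^ k) * K"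
      by (intro mult_left_mono mult_right_mono Suc) (use K(1) in auto)
    finally show ?case by (simp add: mult_ac)
  qed simp
  show ?thesis
  proof (rule summable_comparison_test')
    show "summable (\<lambda>k. norm (mat 1 :: real^'m^'m) * (inverse (fact k) *\<^sub>R (norm L * K) ^ k))"
      by (intro summable_mult summable_exp_generic)
    show "norm ((1 / fact k) *\<^sub>R matpow L k)
        \<le> norm (mat 1 :: real^'m^'m) * (inverse (fact k) *\<^sub>R (norm L * K) ^ k)" for k
      using bound[of k] by (simp add: field_simps)
  qed
qed

lemma mexp_sums: "(\<lambda>k. (1 / fact k) *\<^sub>R matpow L k) sums mexp (L :: real^'m^'m)"
  unfolding mexp_def using summable_matpow by (rule summable_sums)

lemma mexp_0: "mexp (0 :: real^'m^'m) = mat 1"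
proof -
  have "matpow (0 :: real^'m^'m) k = (if k = 0 then mat 1 else 0)" for k
    by (cases k) (auto simp: matmul.zero_left)
  then have "(\<lambda>k. (1 / fact k) *\<^sub>R matpow (0 :: real^'m^'m) k) = (\<lambda>k. if k = 0 then mat 1 else 0)"
    by (auto simp: fun_eq_iff)
  then show ?thesis
    using sums_unique2[OF mexp_sums[of "0 :: real^'m^'m"]]
      sums_If_finite[of "\<lambda>k. k = 0" "\<lambda>_. mat 1 :: real^'m^'m"] by simp
qed

text \<open>Holds term by term, by moving \<open>S\<close> through each power. It serves both for
  commutation (\<open>L = M\<close>) and for similarity, where \<open>S\<close> is the change of
  basis.\<close>

lemma mexp_intertwine:
  assumes "S ** L = M ** S"
  shows "S ** mexp L = mexp M ** (S :: real^'a^'b)"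
proof -
  have "S ** matpow L k = matpow M k ** S" for k
  proof (induction k)
    case (Suc k)
    have "S ** matpow L (Suc k) = M ** (S ** matpow L k)"
      by (simp add: matrix_mul_assoc assms)
    then show ?case
      by (simp add: Suc matrix_mul_assoc)
  qed simp
  moreover have "(\<lambda>k. S ** ((1 / fact k) *\<^sub>R matpow L k)) sums (S ** mexp L)"
    using matmul.bounded_linear_right mexp_sums by (rule bounded_linear.sums)
  moreover have "(\<lambda>k. ((1 / fact k) *\<^sub>R matpow M k) ** S) sums (mexp M ** S)"
    using matmul.bounded_linear_left mexp_sums by (rule bounded_linear.sums)
  ultimately show ?thesis
    by (simp add: matmul.scaleR_left matmul.scaleR_right sums_unique2)
qed

lemma mexp_commute: "L ** mexp (t *\<^sub>R L) = mexp (t *\<^sub>R L) ** L"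
  by (rule mexp_intertwine) (simp add: matmul.scaleR_left matmul.scaleR_right)

text \<open>Each entry is an everywhere convergent power series in \<open>t\<close>. Differentiating
  termwise, the factor k + 1 in \<open>diffs\<close> cancels against the factorial and leaves the
  power k + 1 of \<open>L\<close>, that is, \<open>L ** matpow L k\<close>.\<close>

lemma mexp_has_vector_derivative:
  fixes L :: "real^'m^'m"
  shows "((\<lambda>t. mexp (t *\<^sub>R L)) has_vector_derivative L ** mexp (t *\<^sub>R L)) (at t within S)"
proof -
  have entry: "(\<lambda>k. M k $ i $ j) sums (X $ i $ j)" if "M sums X"
    for M :: "nat \<Rightarrow> real^'m^'m" and X i j
    using bounded_linear.sums[OF bounded_linear_vec_nth
        bounded_linear.sums[OF bounded_linear_vec_nth that]] .
  have entries: "(\<lambda>k. matpow L k $ i $ j / fact k * t ^ k) sums (mexp (t *\<^sub>R L) $ i $ j)" for t i j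
    using entry[OF mexp_sums[of "t *\<^sub>R L"]] by (simp add: matpow_scaleR mult.commute)
  have d: "((\<lambda>t. mexp (t *\<^sub>R L) $ i $ j) has_field_derivative (L ** mexp (t *\<^sub>R L)) $ i $ j) (at t)"
    for i j
  proof -
    let ?c = "\<lambda>k. matpow L k $ i $ j / fact k"
    have "((\<lambda>t. \<Sum>k. ?c k * t ^ k) has_field_derivative (\<Sum>k. diffs ?c k * t ^ k)) (at t)"
      using entries by (intro termdiffs_strong_converges_everywhere sums_summable)
    moreover have "(\<lambda>k. (L ** ((1 / fact k) *\<^sub>R matpow (t *\<^sub>R L) k)) $ i $ j)
        sums ((L ** mexp (t *\<^sub>R L)) $ i $ j)"
      by (intro entry bounded_linear.sums[OF matmul.bounded_linear_right] mexp_sums)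
    then have "(\<lambda>k. diffs ?c k * t ^ k) sums ((L ** mexp (t *\<^sub>R L)) $ i $ j)"
      by (simp add: diffs_def matpow_scaleR matmul.scaleR_right field_simps del: of_nat_Suc)
    then have "(\<Sum>k. diffs ?c k * t ^ k) = (L ** mexp (t *\<^sub>R L)) $ i $ j"
      by (rule sums_unique[symmetric])
    moreover have "(\<lambda>t. \<Sum>k. ?c k * t ^ k) = (\<lambda>t. mexp (t *\<^sub>R L) $ i $ j)"
      using entries by (auto simp: fun_eq_iff intro!: sums_unique[symmetric])
    ultimately show ?thesis
      by simp
  qed
  show ?thesis
    unfolding has_vector_derivative_def
  proof (subst has_derivative_componentwise_within, intro ballI)
    fix b :: "real^'m^'m" assume "b \<in> Basis"
    then obtain i j where b: "b = axis i (axis j 1)"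
      by (auto simp: Basis_vec_def)
    have "((\<lambda>t. mexp (t *\<^sub>R L) $ i $ j) has_vector_derivative (L ** mexp (t *\<^sub>R L)) $ i $ j) (at t within S)"
      using d[of i j] unfolding has_real_derivative_iff_has_vector_derivative
      by (rule has_vector_derivative_at_within)
    then show "((\<lambda>t. mexp (t *\<^sub>R L) \<bullet> b) has_derivative
        (\<lambda>h. (h *\<^sub>R (L ** mexp (t *\<^sub>R L))) \<bullet> b)) (at t within S)"
      by (simp add: b inner_axis has_vector_derivative_def)
  qed
qed

text \<open>For fixed s, the product exp(-t L) exp((t + s) L) has zero derivative in t, hence equals
  its value exp(s L) at t = 0. The case s = 0 provides the inverses needed to rearrange this into
  the group law.\<close>

lemma mexp_add:
  "mexp ((s + t) *\<^sub>R L) = mexp (s *\<^sub>R L) ** mexp (t *\<^sub>R (L :: real^'m^'m))"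
proof -
  have const: "mexp ((- t) *\<^sub>R L) ** mexp ((t + s) *\<^sub>R L) = mexp (s *\<^sub>R L)" for s t
  proof -
    let ?f = "\<lambda>t. mexp ((- t) *\<^sub>R L) ** mexp ((t + s) *\<^sub>R L)"
    have "(?f has_vector_derivative 0) (at t)" for t
    proof -
      have 1: "((\<lambda>t. mexp ((- t) *\<^sub>R L)) has_vector_derivative (-1) *\<^sub>R (L ** mexp ((- t) *\<^sub>R L))) (at t)"
      proof -
        have "(uminus has_vector_derivative - 1) (at t)"
          by (auto intro!: derivative_eq_intros)
        from vector_diff_chain_at[OF this mexp_has_vector_derivative[of L]] show ?thesis
          by (simp add: o_def)
      qed
      have 2: "((\<lambda>t. mexp ((t + s) *\<^sub>R L)) has_vector_derivative 1 *\<^sub>R (L ** mexp ((t + s) *\<^sub>R L))) (at t)"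
      proof -
        have "((\<lambda>t. t + s) has_vector_derivative 1) (at t)"
          by (auto intro!: derivative_eq_intros)
        from vector_diff_chain_at[OF this mexp_has_vector_derivative[of L]] show ?thesis
          by (simp add: o_def)
      qed
      show ?thesis
        using matmul.has_vector_derivative[OF 1 2]
        unfolding mexp_commute[of L "- t"] by (simp add: matmul.minus_left matrix_mul_assoc)
    qed
    then obtain c where "?f t = c" for t
      using has_derivative_zero_constant[of UNIV ?f]
      by (auto simp: has_vector_derivative_def)
    from this[of t] this[of 0] show ?thesis by (simp add: mexp_0)
  qed
  have inv: "mexp ((- t) *\<^sub>R L) ** mexp (t *\<^sub>R L) = mat 1" for t
    using const[of t 0] by (simp add: mexp_0)
  have "mexp (s *\<^sub>R L) ** mexp (t *\<^sub>R L)
      = mexp (s *\<^sub>R L) ** (mexp ((- s) *\<^sub>R L) ** mexp ((s + t) *\<^sub>R L))"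
    by (simp only: const)
  also have "\<dots> = mexp ((s + t) *\<^sub>R L)"
    using inv[of "- s"] by (simp add: matrix_mul_assoc)
  finally show ?thesis ..
qed

lemma mexp_minus_left: "mexp (- L) ** mexp L = mat 1" for L :: "real^'m^'m"
  using mexp_add[of "-1" 1 L] by (simp add: mexp_0)

section \<open>Flows of skew operators\<close>

text \<open>Skewness keeps the norm of \<open>u\<close> constant, so \<open>g t\<close> is the
  cosine of the angle between \<open>u 0\<close> and \<open>u t\<close>. That angle,
  \<open>arccos (g t)\<close>, grows at speed at most \<open>w\<close>.\<close>

lemma inner_ge_cos:
  fixes u :: "real \<Rightarrow> 'a::real_inner"
  assumes der: "\<And>t. (u has_vector_derivative A (u t)) (at t)"
    and skew: "\<And>x. x \<bullet> A x = 0"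
    and bound: "\<And>x. norm (A x) \<le> w * norm x"
    and t: "t \<ge> 0" "w * t \<le> pi" and w: "w \<ge> 0"
  shows "(norm (u 0))\<^sup>2 * cos (w * t) \<le> u 0 \<bullet> u t"
proof (cases "u 0 = 0")
  case False
  define n where "n = norm (u 0)"
  have n: "n > 0" using False by (simp add: n_def)
  have "((\<lambda>t. u t \<bullet> u t) has_real_derivative 0) (at t)" for t
    using bounded_bilinear.has_vector_derivative[OF bounded_bilinear_inner der[of t] der[of t]]
    by (simp add: has_real_derivative_iff_has_vector_derivative skew inner_commute)
  then have "u t \<bullet> u t = u 0 \<bullet> u 0" for t
    by (intro DERIV_isconst_all) auto
  then have norm_u: "norm (u t) = n" for t
    by (simp add: norm_eq_sqrt_inner n_def)
  define g where "g t = (u 0 \<bullet> u t) / n\<^sup>2" for t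
  have abs_g: "\<bar>g t\<bar> \<le> 1" for t
    using Cauchy_Schwarz_ineq2[of "u 0" "u t"] n
    by (simp add: g_def norm_u n_def[symmetric] power2_eq_square divide_le_eq)
  have dg: "(g has_real_derivative (u 0 \<bullet> A (u t)) / n\<^sup>2) (at t)" for t
    unfolding g_def has_real_derivative_iff_has_vector_derivative
    by (intro bounded_linear.has_vector_derivative[OF _ der]
        bounded_linear_divide bounded_linear_compose[OF bounded_linear_divide bounded_linear_inner_right])
  have speed: "\<bar>(u 0 \<bullet> A (u t)) / n\<^sup>2\<bar> \<le> w * sqrt (1 - (g t)\<^sup>2)" for t
  proof -
    \<comment> \<open>The part of \<open>u 0\<close> orthogonal to \<open>u t\<close>. Since
      \<open>A (u t)\<close> is also orthogonal to \<open>u t\<close>, only this part contributes to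
      the derivative, and its norm is n times the sine of the angle.\<close>
    let ?v = "u 0 - g t *\<^sub>R u t"
    have uu: "u 0 \<bullet> u 0 = n\<^sup>2" "u t \<bullet> u t = n\<^sup>2" "u 0 \<bullet> u t = n\<^sup>2 * g t"
      using power2_norm_eq_inner[of "u 0"] power2_norm_eq_inner[of "u t"] n
      unfolding norm_u by (simp_all add: g_def)
    have "?v \<bullet> ?v = u 0 \<bullet> u 0 - 2 * g t * (u 0 \<bullet> u t) + (g t)\<^sup>2 * (u t \<bullet> u t)"
      by (simp add: inner_diff_left inner_diff_right inner_commute power2_eq_square)
    also have "\<dots> = n\<^sup>2 * (1 - (g t)\<^sup>2)"
      unfolding uu by algebra
    finally have "(norm ?v)\<^sup>2 = n\<^sup>2 * (1 - (g t)\<^sup>2)"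
      unfolding power2_norm_eq_inner .
    then have "norm ?v = sqrt (n\<^sup>2 * (1 - (g t)\<^sup>2))"
      using real_sqrt_unique[OF _ norm_ge_zero] by metis
    then have nv: "norm ?v = n * sqrt (1 - (g t)\<^sup>2)"
      using n by (simp add: real_sqrt_mult)
    have "\<bar>u 0 \<bullet> A (u t)\<bar> = \<bar>?v \<bullet> A (u t)\<bar>"
      by (simp add: inner_diff_left skew)
    also have "\<dots> \<le> norm ?v * (w * n)"
      using Cauchy_Schwarz_ineq2[of ?v "A (u t)"] bound[of "u t"]
      by (smt (verit) mult_left_mono norm_ge_zero norm_u)
    finally show ?thesis
      using n by (simp add: nv field_simps power2_eq_square)
  qed
  \<comment> \<open>The factor \<open>r < 1\<close> keeps the argument away from \<open>\<plusminus>1\<close>, where \<open>arccos\<close> is not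
    differentiable; it is removed by a limit.\<close>
  have arccos_le: "arccos (r * g t) \<le> arccos r + w * t" if r: "0 < r" "r < 1" for r
  proof -
    have "arccos (r * g t) - w * t \<le> arccos (r * g 0) - w * 0"
    proof (rule DERIV_nonpos_imp_nonincreasing[OF t(1), where f = "\<lambda>t. arccos (r * g t) - w * t"])
      fix s
      have "r * \<bar>g s\<bar> \<le> r"
        using abs_g[of s] r by (simp add: mult_left_le)
      then have "\<bar>r * g s\<bar> < 1"
        unfolding abs_mult using r by linarith
      then have lt: "- 1 < r * g s" "r * g s < 1" by auto
      have pos: "0 < 1 - (r * g s)\<^sup>2"
        using \<open>\<bar>r * g s\<bar> < 1\<close> by (simp add: abs_square_less_1)
      let ?d = "(u 0 \<bullet> A (u s)) / n\<^sup>2"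
      have "r * \<bar>?d\<bar> \<le> r * (w * sqrt (1 - (g s)\<^sup>2))"
        using speed[of s] r by (intro mult_left_mono) auto
      also have "\<dots> = w * sqrt (r\<^sup>2 * (1 - (g s)\<^sup>2))"
        using r by (simp add: real_sqrt_mult)
      also have "\<dots> \<le> w * sqrt (1 - (r * g s)\<^sup>2)"
        using r w by (intro mult_left_mono real_sqrt_le_mono)
          (auto simp: power_mult_distrib algebra_simps power_le_one)
      finally have le: "r * \<bar>?d\<bar> \<le> w * sqrt (1 - (r * g s)\<^sup>2)" .
      have "- (r * ?d) \<le> r * \<bar>?d\<bar>"
        using r by (metis abs_ge_minus_self abs_mult abs_of_pos)
      also note le
      finally have "- (r * ?d) / sqrt (1 - (r * g s)\<^sup>2) \<le> w"
        using pos by (subst pos_divide_le_eq) auto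
      then have "inverse (- sqrt (1 - (r * g s)\<^sup>2)) * (r * ?d) - w \<le> 0"
        by (simp add: divide_inverse mult.commute)
      moreover have "((\<lambda>t. arccos (r * g t) - w * t) has_real_derivative
          inverse (- sqrt (1 - (r * g s)\<^sup>2)) * (r * ?d) - w) (at s)"
        using lt by (auto intro!: derivative_eq_intros dg)
      ultimately show "\<exists>y. ((\<lambda>t. arccos (r * g t) - w * t) has_real_derivative y) (at s) \<and> y \<le> 0"
        by blast
    qed
    moreover have "g 0 = 1"
      using n by (simp add: g_def n_def power2_norm_eq_inner[symmetric])
    ultimately show ?thesis by simp
  qed
  have "arccos (g t) \<le> w * t"
  proof (rule tendsto_le)
    have r: "((\<lambda>r. r) \<longlongrightarrow> 1) (at_left (1::real))"
      by (rule tendsto_ident_at)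
    have bounds: "\<forall>\<^sub>F r in at_left (1::real). 0 < r \<and> r < 1"
      unfolding eventually_at_left_field by (rule exI[of _ 0]) auto
    have cont: "((\<lambda>r. arccos (r * c)) \<longlongrightarrow> arccos c) (at_left 1)" if "\<bar>c\<bar> \<le> 1" for c
    proof -
      have "\<bar>r * c\<bar> \<le> 1" if "0 < r" "r < 1" for r
        using that \<open>\<bar>c\<bar> \<le> 1\<close> by (auto simp: abs_mult intro!: mult_le_one)
      then have ev: "\<forall>\<^sub>F r in at_left 1. r * c \<in> {-1..1}"
        using eventually_mono[OF bounds] by (smt (verit) abs_le_iff atLeastAtMost_iff)
      have "((\<lambda>r. r * c) \<longlongrightarrow> c) (at_left 1)"
        using tendsto_mult_right[OF r, of c] by simp
      with ev show ?thesis
        by (intro continuous_on_tendsto_compose[OF continuous_on_arccos']) (use that in auto)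
    qed
    show "((\<lambda>r. arccos (r * g t)) \<longlongrightarrow> arccos (g t)) (at_left 1)"
      using cont[OF abs_g] .
    show "((\<lambda>r. arccos r + w * t) \<longlongrightarrow> w * t) (at_left 1)"
      using tendsto_add[OF cont[of 1] tendsto_const[of "w * t"]] by simp
    show "\<forall>\<^sub>F r in at_left 1. arccos (r * g t) \<le> arccos r + w * t"
      using bounds by (rule eventually_mono) (simp add: arccos_le)
  qed simp
  then have "cos (w * t) \<le> cos (arccos (g t))"
    using t w abs_g[of t] by (intro cos_monotone_0_pi_le arccos_lbound) auto
  then have "cos (w * t) \<le> g t"
    using abs_g[of t] by (simp add: cos_arccos_abs)
  then show ?thesis
    using n by (simp add: g_def n_def[symmetric] field_simps)
qed simp

text \<open>Integrating the cosine bound over [0, t] bounds the displacement along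
  \<open>u 0\<close> below by \<open>c * sin (w * t) / w\<close>, which is positive because
  \<open>w * t < pi\<close>. The function \<open>?h\<close> subtracts this bound and is
  monotone.\<close>

lemma displacement_pos:
  fixes y u :: "real \<Rightarrow> 'a::real_inner"
  assumes dy: "\<And>t. (y has_vector_derivative u t) (at t)"
    and du: "\<And>t. (u has_vector_derivative A (u t)) (at t)"
    and skew: "\<And>x. x \<bullet> A x = 0"
    and bound: "\<And>x. norm (A x) \<le> w * norm x"
    and t: "t > 0" and w: "w > 0" "w * t < pi" and u0: "u 0 \<noteq> 0"
  shows "u 0 \<bullet> y 0 < u 0 \<bullet> y t"
proof -
  define c where "c = (norm (u 0))\<^sup>2"
  let ?h = "\<lambda>t. u 0 \<bullet> y t - c * sin (w * t) / w"
  have "?h 0 \<le> ?h t"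
  proof (rule DERIV_nonneg_imp_nondecreasing[where f = ?h])
    fix s assume s: "0 \<le> s" "s \<le> t"
    have "w * s \<le> w * t" using s w by (intro mult_left_mono) auto
    then have "w * s \<le> pi" using w by linarith
    then have "c * cos (w * s) \<le> u 0 \<bullet> u s"
      unfolding c_def using w s by (intro inner_ge_cos[OF du skew bound]) auto
    moreover have "((\<lambda>t. u 0 \<bullet> y t) has_real_derivative u 0 \<bullet> u s) (at s)"
      unfolding has_real_derivative_iff_has_vector_derivative
      by (rule bounded_linear.has_vector_derivative[OF bounded_linear_inner_right dy])
    then have "(?h has_real_derivative u 0 \<bullet> u s - c * cos (w * s)) (at s)"
      using w by (auto intro!: derivative_eq_intros)
    ultimately show "\<exists>y. (?h has_real_derivative y) (at s) \<and> 0 \<le> y"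
      by force
  qed (use t in auto)
  moreover have "c * sin (w * t) / w > 0"
    using t w u0 by (auto simp: c_def intro!: divide_pos_pos mult_pos_pos sin_gt_zero)
  ultimately show ?thesis by simp
qed

text \<open>Time reversal: the reversed velocity obeys the equation with generator -A, which is skew
  with the same bound.\<close>

lemma displacement_pos_backward:
  fixes y u :: "real \<Rightarrow> 'a::real_inner"
  assumes dy: "\<And>t. (y has_vector_derivative u t) (at t)"
    and du: "\<And>t. (u has_vector_derivative A (u t)) (at t)"
    and skew: "\<And>x. x \<bullet> A x = 0"
    and bound: "\<And>x. norm (A x) \<le> w * norm x"
    and t: "t > 0" and w: "w > 0" "w * t < pi" and u0: "u 0 \<noteq> 0"
  shows "u 0 \<bullet> y (- t) < u 0 \<bullet> y 0"
proof -
  have flip: "((\<lambda>t. f (- t)) has_vector_derivative - f' (- t)) (at t)"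
    if "\<And>t. (f has_vector_derivative f' t) (at t)" for f f' :: "real \<Rightarrow> 'a" and t
  proof -
    have "(uminus has_vector_derivative - 1) (at t)"
      by (auto intro!: derivative_eq_intros)
    from vector_diff_chain_at[OF this that] show ?thesis
      by (simp add: o_def)
  qed
  have "u (- 0) \<bullet> - y (- 0) < u (- 0) \<bullet> - y (- t)"
  proof (rule displacement_pos[where A = "\<lambda>x. - A x" and u = "\<lambda>t. u (- t)" and y = "\<lambda>t. - y (- t)"])
    show "((\<lambda>t. - y (- t)) has_vector_derivative u (- t)) (at t)" for t
      using has_vector_derivative_minus[OF flip[OF dy]] by simp
    show "((\<lambda>t. u (- t)) has_vector_derivative - A (u (- t))) (at t)" for t
      using flip[OF du] .
  qed (use assms in auto)
  then show ?thesis by simp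
qed

section \<open>Principal logarithms of orthogonal matrices\<close>

lemma transpose_mexp: "transpose (mexp L) = mexp (transpose L)" for L :: "real^'m^'m"
proof -
  have "transpose (matpow L k) = matpow (transpose L) k" for k
    by (induction k) (auto simp: matrix_transpose_mul matpow_commute)
  then have "(\<lambda>k. (1 / fact k) *\<^sub>R matpow (transpose L) k) sums transpose (mexp L)"
    using bounded_linear.sums[OF bounded_linear_matrix_transpose mexp_sums[of L]]
    by (simp add: linear_scale[OF bounded_linear.linear[OF bounded_linear_matrix_transpose]])
  then show ?thesis
    using mexp_sums by (rule sums_unique2)
qed

text \<open>The two real equations say that \<open>a\<close> and \<open>b\<close> are the real and
  imaginary parts of a complex eigenvector: L (a + i b) = i \<theta> (a + i b).\<close>

lemma is_eigenvalue_imaginaryI: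
  fixes L :: "real^'m^'m"
  assumes a: "L *v a = - (\<theta> *\<^sub>R b)" and b: "L *v b = \<theta> *\<^sub>R a" and nz: "a \<noteq> 0 \<or> b \<noteq> 0"
  shows "is_eigenvalue L (Complex 0 \<theta>)"
proof -
  define M :: "complex^'m^'m" where
    "M = (\<chi> i j. (if i = j then Complex 0 \<theta> else 0) - complex_of_real (L $ i $ j))"
  define w :: "complex^'m" where "w = (\<chi> i. Complex (a $ i) (b $ i))"
  have "(M *v w) $ i = 0" for i
  proof -
    have "(\<Sum>j\<in>UNIV. complex_of_real (L $ i $ j) * w $ j)
        = Complex ((L *v a) $ i) ((L *v b) $ i)"
      by (simp add: w_def matrix_vector_mult_def complex_eq_iff)
    moreover have "(\<Sum>j\<in>UNIV. (if i = j then Complex 0 \<theta> else 0) * w $ j) = Complex 0 \<theta> * w $ i"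
      by (simp add: if_distrib[of "\<lambda>x. x * _"] cong: if_cong)
    moreover have "(M *v w) $ i = (\<Sum>j\<in>UNIV. (if i = j then Complex 0 \<theta> else 0) * w $ j)
        - (\<Sum>j\<in>UNIV. complex_of_real (L $ i $ j) * w $ j)"
      by (simp add: M_def matrix_vector_mult_def left_diff_distrib sum_subtractf)
    ultimately have "(M *v w) $ i = Complex 0 \<theta> * w $ i - Complex ((L *v a) $ i) ((L *v b) $ i)"
      by (simp only:)
    then show ?thesis
      by (simp add: a b w_def complex_eq_iff)
  qed
  then have "M *v w = 0" by (simp add: vec_eq_iff)
  moreover have "w \<noteq> 0"
    using nz by (auto simp: w_def vec_eq_iff complex_eq_iff)
  ultimately have "\<not> invertible M"
    by (metis invertible_def matrix_left_invertible_ker)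
  then show ?thesis
    by (simp add: is_eigenvalue_def invertible_det_nz M_def)
qed

section \<open>Norm and spectrum of skew matrices\<close>

lemma skew_inner_self:
  fixes K :: "real^'m^'m"
  assumes "transpose K = - K"
  shows "x \<bullet> (K *v x) = 0"
  using inner_matrix_vector_mult[of x K x] assms
  by (simp add: minus_matrix_vector_mult inner_commute)

text \<open>The operator norm \<open>\<theta>\<close> of a skew matrix is attained at some unit \<open>x\<close>; equality in
  Cauchy--Schwarz forces \<open>K\<^sup>2 x = - \<theta>\<^sup>2 x\<close>, so \<open>K x + \<i> \<theta> x\<close> is an eigenvector.\<close>
lemma skew_norm_attained:
  fixes K :: "real^'m^'m"
  assumes K: "transpose K = - K"
  obtains \<theta> x where "\<theta> \<ge> 0" "x \<noteq> 0" "\<And>y. norm (K *v y) \<le> \<theta> * norm y"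
    "K *v (K *v x) = - (\<theta> * \<theta>) *\<^sub>R x"
proof -
  let ?S = "sphere 0 1 :: (real^'m) set"
  have "continuous_on ?S (\<lambda>x. norm (K *v x))"
    by (intro continuous_intros matrix_vector_mult_linear_continuous_on)
  moreover have "axis undefined 1 \<in> ?S" by (simp add: norm_axis_1)
  ultimately obtain x where x: "x \<in> ?S" and max: "\<And>y. y \<in> ?S \<Longrightarrow> norm (K *v y) \<le> norm (K *v x)"
    using continuous_attains_sup[of ?S "\<lambda>x. norm (K *v x)"] by (metis compact_sphere empty_iff)
  define \<theta> where "\<theta> = norm (K *v x)"
  have bound: "norm (K *v y) \<le> \<theta> * norm y" for y
  proof (cases "y = 0")
    case False
    then have "norm (K *v ((1 / norm y) *\<^sub>R y)) \<le> \<theta>"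
      unfolding \<theta>_def by (intro max) simp
    then show ?thesis
      using False by (simp add: matrix_vector_mult_scaleR field_simps)
  qed simp
  let ?v = "K *v (K *v x)"
  have n: "x \<bullet> x = 1" using x by (simp add: norm_eq_1)
  have "?v \<bullet> x = - ((K *v x) \<bullet> (K *v x))"
    by (simp add: inner_matrix_vector_mult_left K minus_matrix_vector_mult)
  then have vx: "?v \<bullet> x = - (\<theta> * \<theta>)"
    by (simp add: \<theta>_def power2_norm_eq_inner[symmetric] power2_eq_square)
  have "norm ?v \<le> \<theta> * \<theta>"
    using bound[of "K *v x"] by (simp add: \<theta>_def)
  then have "(norm ?v)\<^sup>2 \<le> (\<theta> * \<theta>)\<^sup>2"
    by (rule power_mono) simp
  then have vv: "?v \<bullet> ?v \<le> (\<theta> * \<theta>)\<^sup>2"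
    by (simp add: power2_norm_eq_inner)
  have "(?v + (\<theta> * \<theta>) *\<^sub>R x) \<bullet> (?v + (\<theta> * \<theta>) *\<^sub>R x)
      = ?v \<bullet> ?v + 2 * (\<theta> * \<theta>) * (?v \<bullet> x) + (\<theta> * \<theta>)\<^sup>2 * (x \<bullet> x)"
    by (simp add: inner_add_left inner_add_right inner_commute power2_eq_square algebra_simps)
  also have "\<dots> \<le> 0"
    using vv by (simp add: vx n power2_eq_square)
  finally have "?v + (\<theta> * \<theta>) *\<^sub>R x = 0"
    by (metis inner_ge_zero inner_eq_zero_iff order_antisym)
  then have "?v = - (\<theta> * \<theta>) *\<^sub>R x"
    by (simp add: add_eq_0_iff2)
  then show ?thesis
  proof (rule that[rotated 3])
    show "0 \<le> \<theta>" by (simp add: \<theta>_def)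
    show "x \<noteq> 0" using n by auto
  qed (rule bound)
qed

text \<open>The norm of the skew matrix \<open>K\<close> is the modulus of one of its imaginary
  eigenvalues. Similarity transports that eigenvalue to \<open>L\<close>, where \<open>strip\<close>
  applies; \<open>L\<close> itself need not be skew.\<close>

lemma skew_norm_less_pi:
  fixes K L T :: "real^'m^'m"
  assumes K: "transpose K = - K" and conj: "T ** K = L ** T" "invertible T"
    and strip: "\<And>\<mu>. is_eigenvalue L \<mu> \<Longrightarrow> Im \<mu> < pi"
  obtains \<theta> where "0 < \<theta>" "\<theta> < pi" "\<And>y. norm (K *v y) \<le> \<theta> * norm y"
proof -
  obtain \<theta> x where \<theta>: "\<theta> \<ge> 0" "x \<noteq> 0" "\<And>y. norm (K *v y) \<le> \<theta> * norm y"
      "K *v (K *v x) = - (\<theta> * \<theta>) *\<^sub>R x"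
    using skew_norm_attained[OF K] by blast
  have LT: "L *v (T *v y) = T *v (K *v y)" for y
    by (simp add: matrix_vector_mul_assoc conj)
  have "\<theta> < pi"
  proof (cases "\<theta> = 0")
    case False
    obtain T' where "T' ** T = mat 1"
      using conj(2) by (auto simp: invertible_def)
    then have "T' *v (T *v x) = x"
      by (simp add: matrix_vector_mul_assoc)
    then have "T *v x \<noteq> 0"
      using \<theta>(2) by auto
    with False have "is_eigenvalue L (Complex 0 \<theta>)"
      by (intro is_eigenvalue_imaginaryI[of _ "T *v (K *v x)" _ "\<theta> *\<^sub>R (T *v x)"])
        (simp_all add: LT \<theta>(4) matrix_vector_mult_scaleR matrix_vector_mult_minus)
    then show ?thesis using strip by force
  qed simp
  \<comment> \<open>The norm may be 0, while a strictly positive bound is wanted; 1 lies below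
    pi.\<close>
  then have "norm (K *v y) \<le> max \<theta> 1 * norm y" for y
    using \<theta>(3)[of y] by (meson max.cobounded1 mult_right_mono norm_ge_zero order_trans)
  then show ?thesis
    using that[of "max \<theta> 1"] \<open>\<theta> < pi\<close> pi_gt3 by auto
qed

text \<open>The curve \<open>exp (t K) Z exp (- t K)\<close> is closed over \<open>[-1/2, 1/2]\<close>, but its generator
  \<open>ad K\<close> is skew of norm at most \<open>2 \<theta> < 2 \<pi>\<close>, so it cannot return unless it is constant.\<close>
lemma commute_of_commute_mexp:
  fixes K Z :: "real^'m^'m"
  assumes K: "transpose K = - K" and bound: "\<And>y. norm (K *v y) \<le> \<theta> * norm y"
    and \<theta>: "0 < \<theta>" "\<theta> < pi" and comm: "Z ** mexp K = mexp K ** Z"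
  shows "Z ** K = K ** Z"
proof (rule ccontr)
  assume neq: "Z ** K \<noteq> K ** Z"
  define F where "F t = mexp (t *\<^sub>R K)" for t
  define c where "c M t = F t ** M ** F (- t)" for M t
  define ad where "ad M = K ** M - M ** K" for M
  have KF: "K ** F t = F t ** K" for t
    by (simp add: F_def mexp_commute)
  have FF: "F s ** F t = F (s + t)" for s t
    by (simp add: F_def mexp_add)
  have dF: "(F has_vector_derivative K ** F t) (at t)" for t
    unfolding F_def by (rule mexp_has_vector_derivative)
  have dF': "((\<lambda>t. F (- t)) has_vector_derivative - (K ** F (- t))) (at t)" for t
  proof -
    have "(uminus has_vector_derivative - 1) (at t)"
      by (auto intro!: derivative_eq_intros)
    from vector_diff_chain_at[OF this dF] show ?thesis
      by (simp add: o_def)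
  qed
  have dc: "(c M has_vector_derivative ad (c M t)) (at t)" for M t
  proof -
    have "(c M has_vector_derivative (F t ** M) ** - (K ** F (- t)) + (K ** F t) ** M ** F (- t)) (at t)"
      unfolding c_def
      by (rule matmul.has_vector_derivative[OF
            bounded_linear.has_vector_derivative[OF matmul.bounded_linear_left dF] dF'])
    then show ?thesis
      unfolding KF[of "- t"] by (simp add: ad_def c_def matrix_mul_assoc matmul.minus_right)
  qed
  \<comment> \<open>Thus the velocity of the curve \<open>c Z\<close> is the curve
    \<open>c (ad Z)\<close>, which obeys the same linear equation, as the displacement lemmas
    require.\<close>
  have ad_c: "ad (c M t) = c (ad M) t" for M t
    by (simp add: ad_def c_def matmul.diff_right matmul.diff_left matrix_mul_assoc KF)
       (simp add: matrix_mul_assoc[symmetric] KF)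
  have skew: "M \<bullet> ad M = 0" for M
  proof -
    have half: "X \<bullet> (K ** X) = 0" for X :: "real^'m^'m"
      using inner_matrix_matrix_mult[of X K X] by (simp add: K matmul.minus_left inner_commute)
    have "M \<bullet> (M ** K) = transpose M \<bullet> (transpose K ** transpose M)"
      by (simp add: matrix_transpose_mul[symmetric] inner_transpose)
    then show ?thesis
      by (simp add: ad_def inner_diff_right half K matmul.minus_left)
  qed
  have norm_ad: "norm (ad M) \<le> 2 * \<theta> * norm M" for M
  proof -
    have "norm (M ** K) = norm (K ** transpose M)"
      by (metis K matrix_transpose_mul matmul.minus_left norm_minus_cancel norm_transpose)
    also have "\<dots> \<le> \<theta> * norm M"
      using norm_matrix_mult_le[OF bound, of "transpose M"] by (simp add: norm_transpose)
    finally show ?thesis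
      using norm_matrix_mult_le[OF bound, of M] norm_triangle_ineq4[of "K ** M" "M ** K"]
      by (simp add: ad_def)
  qed
  have c0: "c M 0 = M" for M
    by (simp add: c_def F_def mexp_0)
  have dy: "(c Z has_vector_derivative c (ad Z) t) (at t)" for t
    using dc[of Z t] by (simp add: ad_c)
  have nz: "c (ad Z) 0 \<noteq> 0"
    using neq by (simp add: c0 ad_def)
  \<comment> \<open>Splitting the unit period at its midpoint turns the speed bound 2 \<theta> into
    an angle of at most \<theta> on each half.\<close>
  have half: "2 * \<theta> * (1 / 2) < pi" "0 < 2 * \<theta>" "(0::real) < 1 / 2"
    using \<theta> by auto
  have "c (ad Z) 0 \<bullet> c Z 0 < c (ad Z) 0 \<bullet> c Z (1 / 2)"
    by (rule displacement_pos[OF dy dc skew norm_ad half(3,2,1) nz])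
  moreover have "c (ad Z) 0 \<bullet> c Z (- (1 / 2)) < c (ad Z) 0 \<bullet> c Z 0"
    by (rule displacement_pos_backward[OF dy dc skew norm_ad half(3,2,1) nz])
  moreover have "c Z (1 / 2) = c Z (- (1 / 2))"
  proof -
    have "c Z (1 / 2) = F (- (1 / 2)) ** (F 1 ** Z) ** F (- (1 / 2))"
      by (simp add: c_def matrix_mul_assoc FF)
    also have "F 1 ** Z = Z ** F 1"
      using comm by (simp add: F_def)
    also have "F (- (1 / 2)) ** (Z ** F 1) ** F (- (1 / 2))
        = F (- (1 / 2)) ** Z ** (F 1 ** F (- (1 / 2)))"
      by (simp add: matrix_mul_assoc)
    also have "\<dots> = c Z (- (1 / 2))"
      by (simp add: c_def FF)
    finally show ?thesis .
  qed
  ultimately show False by simp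
qed

text \<open>Gram-Schmidt for the inner product given by \<open>G\<close>: a
  \<open>G\<close>-orthonormal family is built one index at a time, and its vectors are the columns
  of \<open>T\<close>.\<close>

lemma congruent_to_identity:
  fixes G :: "real^'m^'m"
  assumes sym: "transpose G = G" and pos: "\<And>x. x \<noteq> 0 \<Longrightarrow> 0 < x \<bullet> (G *v x)"
  obtains T :: "real^'m^'m" where "transpose T ** G ** T = mat 1"
proof -
  have "\<exists>q. \<forall>i\<in>S. \<forall>j\<in>S. q i \<bullet> (G *v q j) = (if i = j then 1 else 0)" for S :: "'m set"
    using finite[of S]
  proof (induction S)
    case (insert k S)
    then obtain q where q: "\<And>i j. i \<in> S \<Longrightarrow> j \<in> S \<Longrightarrow> q i \<bullet> (G *v q j) = (if i = j then 1 else 0)"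
      using insert.IH by blast
    let ?W = "(\<lambda>i. G *v q i) ` S"
    have "dim ?W \<le> card ?W"
      by (rule dim_le_card') simp
    also have "\<dots> \<le> card S" by (rule card_image_le) simp
    \<comment> \<open>As \<open>k\<close> is not in \<open>S\<close>, the images under
      \<open>G\<close> cannot span the space. A vector that is Euclidean-orthogonal to all of them
      is \<open>G\<close>-orthogonal to the family.\<close>
    also have "\<dots> < CARD('m)"
      using insert.hyps by (intro psubset_card_mono) auto
    finally have "dim ?W < DIM(real^'m)" by simp
    then obtain x where "x \<noteq> 0" and perp: "\<And>y. y \<in> span ?W \<Longrightarrow> orthogonal x y"
      using orthogonal_to_subspace_exists[of ?W] by metis
    then have x: "x \<noteq> 0" "\<And>i. i \<in> S \<Longrightarrow> orthogonal x (G *v q i)"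
      by (auto intro!: perp span_base)
    define p where "p = (1 / sqrt (x \<bullet> (G *v x))) *\<^sub>R x"
    have pp: "p \<bullet> (G *v p) = 1"
      using pos[OF x(1)] by (simp add: p_def matrix_vector_mult_scaleR)
    have pq: "p \<bullet> (G *v q i) = 0" "q i \<bullet> (G *v p) = 0" if "i \<in> S" for i
    proof -
      show "p \<bullet> (G *v q i) = 0"
        using x(2)[OF that] by (simp add: p_def orthogonal_def)
      then show "q i \<bullet> (G *v p) = 0"
        by (metis inner_matrix_vector_mult inner_commute sym)
    qed
    show ?case
      using insert.hyps q pp pq by (intro exI[of _ "q(k := p)"]) auto
  qed auto
  from this[of UNIV] obtain q :: "'m \<Rightarrow> real^'m" where q: "\<And>i j. q i \<bullet> (G *v q j) = (if i = j then 1 else 0)"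
    by blast
  define T :: "real^'m^'m" where "T = (\<chi> r c. q c $ r)"
  have "(transpose T ** (G ** T)) $ i $ j = q i \<bullet> (G *v q j)" for i j
    by (simp add: T_def matrix_matrix_mult_def transpose_def
        inner_vec_def matrix_vector_mult_def)
  then have "transpose T ** G ** T = mat 1"
    by (simp add: vec_eq_iff q mat_def matrix_mul_assoc)
  then show ?thesis using that by blast
qed

text \<open>The average of \<open>F(t)\<^sup>T F(t)\<close>, \<open>F(t) = exp (t L)\<close>, over its period
  \<open>[0, 1]\<close> is an inner product for which \<open>L\<close> is skew.\<close>
lemma invariant_inner_product:
  fixes L :: "real^'m^'m"
  assumes orth: "transpose (mexp L) ** mexp L = mat 1"
  obtains G where "transpose G = G" "\<And>x. x \<noteq> 0 \<Longrightarrow> 0 < x \<bullet> (G *v x)"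
    "transpose L ** G + G ** L = 0"
proof -
  define F where "F t = mexp (t *\<^sub>R L)" for t
  define P where "P t = transpose (F t) ** F t" for t
  define G where "G = integral {0..1} P"
  have dF: "(F has_vector_derivative L ** F t) (at t within S)" for t S
    unfolding F_def by (rule mexp_has_vector_derivative)
  have dP: "(P has_vector_derivative transpose L ** P t + P t ** L) (at t within S)" for t S
  proof -
    have LF: "L ** F t = F t ** L"
      by (simp add: F_def mexp_commute)
    have "(P has_vector_derivative transpose (F t) ** (L ** F t) + transpose (L ** F t) ** F t)
        (at t within S)"
      unfolding P_def
      by (rule matmul.has_vector_derivative[OF
          bounded_linear.has_vector_derivative[OF bounded_linear_matrix_transpose dF] dF])
    then show ?thesis
      unfolding LF by (simp add: P_def matrix_transpose_mul matrix_mul_assoc add.commute)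
  qed
  have contP: "continuous_on {0..1} P"
    using dP by (meson continuous_on_eq_continuous_within has_vector_derivative_continuous)
  then have intP: "(P has_integral G) {0..1}"
    unfolding G_def by (intro integrable_integral integrable_continuous_real)
  \<comment> \<open>The derivative of \<open>P\<close> is integrated in two ways: by its endpoint
    values, which are both the identity by \<open>orth\<close>, and by linearity in terms of
    \<open>G\<close>.\<close>
  have int1: "((\<lambda>t. transpose L ** P t + P t ** L) has_integral P 1 - P 0) {0..1}"
    by (rule fundamental_theorem_of_calculus) (auto intro: dP)
  have int2: "((\<lambda>t. transpose L ** P t + P t ** L) has_integral transpose L ** G + G ** L) {0..1}"
    by (rule has_integral_add[OF
          has_integral_linear[OF intP matmul.bounded_linear_right[of "transpose L"], unfolded o_def]
          has_integral_linear[OF intP matmul.bounded_linear_left[of L], unfolded o_def]])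
  have "transpose L ** G + G ** L = 0"
    using has_integral_unique[OF int2 int1] orth by (simp add: P_def F_def mexp_0)
  moreover have "transpose G = G"
  proof -
    have "transpose \<circ> P = P"
      by (auto simp: P_def matrix_transpose_mul fun_eq_iff)
    then show ?thesis
      using has_integral_unique[OF has_integral_linear[OF intP bounded_linear_matrix_transpose]] intP
      by simp
  qed
  moreover have "0 < x \<bullet> (G *v x)" if "x \<noteq> 0" for x
  proof -
    have lin: "bounded_linear (\<lambda>M :: real^'m^'m. x \<bullet> (M *v x))"
      unfolding linear_conv_bounded_linear[symmetric]
      by (intro linearI) (auto simp: matrix_vector_mult_add_rdistrib inner_add_right
          scaleR_matrix_vector_assoc[symmetric])
    define h where "h t = x \<bullet> (P t *v x)" for t
    have h: "h t = (F t *v x) \<bullet> (F t *v x)" for t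
      by (simp add: h_def P_def inner_matrix_vector_mult_left matrix_vector_mul_assoc)
    have int: "(h has_integral x \<bullet> (G *v x)) {0..1}"
      using has_integral_linear[OF intP lin] by (simp add: o_def h_def[abs_def])
    \<comment> \<open>A nonnegative continuous function with zero integral vanishes, but
      \<open>h 0\<close> is the squared norm of \<open>x\<close>.\<close>
    have "x \<bullet> (G *v x) \<noteq> 0"
    proof
      assume "x \<bullet> (G *v x) = 0"
      with int have "(h has_integral 0) (cbox 0 1)" by simp
      moreover have "continuous_on (cbox 0 1) h"
        unfolding h_def using bounded_linear.continuous_on[OF lin contP] by simp
      ultimately have "h 0 = 0"
        by (intro has_integral_0_cbox_imp_0[of 0 1 h 0]) (auto simp: h)
      then show False
        using that by (simp add: h F_def mexp_0)
    qed
    moreover have "0 \<le> x \<bullet> (G *v x)"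
      using int by (rule has_integral_nonneg) (simp add: h)
    ultimately show ?thesis by simp
  qed
  ultimately show ?thesis using that by blast
qed

text \<open>In a \<open>G\<close>-orthonormal basis \<open>L\<close> becomes the skew matrix
  \<open>K\<close>. The standard inner product becomes \<open>Z\<close> in that basis. Orthogonality
  of \<open>mexp L\<close> makes \<open>Z\<close> commute with \<open>mexp K\<close>, hence with
  \<open>K\<close>, and this last relation, read in the original basis, is skewness of
  \<open>L\<close>.\<close>

lemma skew_of_principal_log:
  fixes L :: "real^'m^'m"
  assumes orth: "transpose (mexp L) ** mexp L = mat 1"
    and strip: "\<And>\<mu>. is_eigenvalue L \<mu> \<Longrightarrow> Im \<mu> < pi"
  shows "transpose L = - L"
proof -
  obtain G where G: "transpose G = G" "\<And>x. x \<noteq> 0 \<Longrightarrow> 0 < x \<bullet> (G *v x)"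
      "transpose L ** G + G ** L = 0"
    using invariant_inner_product[OF orth] by blast
  obtain T :: "real^'m^'m" where T: "transpose T ** G ** T = mat 1"
    using congruent_to_identity[OF G(1,2)] by blast
  define S where "S = transpose T ** G"
  have ST: "S ** T = mat 1" using T by (simp add: S_def)
  then have TS: "T ** S = mat 1" by (rule matrix_left_right_inverse[THEN iffD1])
  define K where "K = S ** L ** T"
  have TK: "T ** K = L ** T"
    by (simp add: K_def matrix_mul_assoc TS)
  have "transpose K = transpose T ** (transpose L ** G) ** T"
    by (simp add: K_def S_def matrix_transpose_mul G(1) matrix_mul_assoc)
  also have "transpose L ** G = - (G ** L)"
    using G(3) by (simp add: eq_neg_iff_add_eq_0)
  finally have K: "transpose K = - K"
    by (simp add: K_def S_def matmul.minus_left matmul.minus_right matrix_mul_assoc)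
  obtain \<theta> where \<theta>: "0 < \<theta>" "\<theta> < pi" "\<And>y. norm (K *v y) \<le> \<theta> * norm y"
    using skew_norm_less_pi[OF K TK] strip ST TS by (metis invertible_def)
  define Z where "Z = transpose T ** T"
  have TE: "T ** mexp K = mexp L ** T"
    by (rule mexp_intertwine[OF TK])
  have "mexp (- K) ** Z ** mexp K = transpose (T ** mexp K) ** (T ** mexp K)"
    by (simp add: Z_def matrix_transpose_mul transpose_mexp K matrix_mul_assoc)
  also have "\<dots> = transpose T ** (transpose (mexp L) ** mexp L) ** T"
    by (simp only: TE matrix_transpose_mul matrix_mul_assoc)
  finally have "mexp (- K) ** Z ** mexp K = Z"
    by (simp add: orth Z_def)
  then have "mexp K ** (mexp (- K) ** Z ** mexp K) = mexp K ** Z" by simp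
  then have "Z ** mexp K = mexp K ** Z"
    using mexp_minus_left[of "- K"] by (simp add: matrix_mul_assoc)
  then have "Z ** K = K ** Z"
    using commute_of_commute_mexp[OF K \<theta>(3,1,2)] by blast
  moreover have "Z ** K = transpose T ** L ** T"
    by (simp add: Z_def matrix_mul_assoc[symmetric] TK)
  moreover have "K ** Z = - (transpose T ** transpose L ** T)"
  proof -
    have "K ** Z = - (transpose (T ** K) ** T)"
      by (simp add: Z_def matrix_transpose_mul K matmul.minus_left matrix_mul_assoc)
    then show ?thesis
      unfolding TK by (simp add: matrix_transpose_mul)
  qed
  ultimately have "transpose T ** transpose L ** T = transpose T ** (- L) ** T"
    by (simp add: matmul.minus_left matmul.minus_right)
  then have "transpose S ** (transpose T ** transpose L ** T) ** S
      = transpose S ** (transpose T ** (- L) ** T) ** S" by simp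
  moreover have "transpose S ** (transpose T ** M ** T) ** S = M" for M
  proof -
    have "transpose S ** (transpose T ** M ** T) ** S = transpose (T ** S) ** M ** (T ** S)"
      by (simp add: matrix_transpose_mul matrix_mul_assoc)
    then show ?thesis by (simp add: TS)
  qed
  ultimately show ?thesis by simp
qed

section \<open>QR decompositions and block matrices\<close>

text \<open>Gram-Schmidt on the columns of \<open>W\<close>, which may be linearly dependent. Adding
  indices in increasing order makes each column a combination of the q's up to its own index, whence
  \<open>R\<close> is triangular.\<close>

lemma thin_qr_exists:
  fixes W :: "((real, 'p::{finite,linorder}) vec, 'n::finite) vec"
  assumes "CARD('p) \<le> CARD('n)"
  shows "\<exists>Q R. thin_qr W Q R"
proof -
  define w where "w j = column j W" for j
  have "\<exists>q. (\<forall>i\<in>S. \<forall>j\<in>S. q i \<bullet> q j = (if i = j then 1 else 0)) \<and>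
      (\<forall>j\<in>S. w j = (\<Sum>i\<in>{i\<in>S. i \<le> j}. (q i \<bullet> w j) *\<^sub>R q i))" for S :: "'p set"
    using finite[of S]
  proof (induction S rule: finite_linorder_max_induct)
    case (insert k S)
    obtain q :: "'p \<Rightarrow> (real, 'n) vec"
      where q: "\<And>i j. i \<in> S \<Longrightarrow> j \<in> S \<Longrightarrow> q i \<bullet> q j = (if i = j then 1 else 0)"
        and w: "\<And>j. j \<in> S \<Longrightarrow> w j = (\<Sum>i\<in>{i\<in>S. i \<le> j}. (q i \<bullet> w j) *\<^sub>R q i)"
      using insert.IH by blast
    have k: "k \<notin> S" using insert.hyps by auto
    define r where "r = w k - (\<Sum>i\<in>S. (q i \<bullet> w k) *\<^sub>R q i)"
    have qr: "q i \<bullet> r = 0" if "i \<in> S" for i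
    proof -
      have "q i \<bullet> (\<Sum>j\<in>S. (q j \<bullet> w k) *\<^sub>R q j) = (\<Sum>j\<in>S. if i = j then q j \<bullet> w k else 0)"
        unfolding inner_sum_right using q that by (intro sum.cong) auto
      then show ?thesis using that by (simp add: r_def inner_diff_right)
    qed
    obtain p where p: "p \<bullet> p = 1" "\<And>i. i \<in> S \<Longrightarrow> q i \<bullet> p = 0" "r = (p \<bullet> r) *\<^sub>R p"
    proof (cases "r = 0")
      case False
      have "((1 / norm r) *\<^sub>R r) \<bullet> r = norm r"
        using False by (simp add: power2_norm_eq_inner[symmetric] power2_eq_square)
      then show ?thesis
        using False qr
        by (intro that[of "(1 / norm r) *\<^sub>R r"])
          (auto simp: power2_norm_eq_inner[symmetric] power2_eq_square)
    next
      \<comment> \<open>The new column depends on the earlier q's and enters with coefficient 0, so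
        any unit vector orthogonal to them will do. One exists since
        \<open>CARD('p) \<le> CARD('n)\<close>.\<close>
      case True
      have "dim (q ` S) \<le> card (q ` S)"
        by (rule dim_le_card') simp
      also have "\<dots> \<le> card S" by (rule card_image_le) simp
      also have "\<dots> < CARD('p)"
        using k by (intro psubset_card_mono) auto
      also have "\<dots> \<le> CARD('n)" by (rule assms)
      finally have "dim (q ` S) < DIM(real^'n)" by simp
      then obtain x where x: "x \<noteq> 0" "\<And>y. y \<in> span (q ` S) \<Longrightarrow> orthogonal x y"
        using orthogonal_to_subspace_exists[of "q ` S"] by metis
      have "x \<bullet> q i = 0" if "i \<in> S" for i
        using x(2)[OF span_base[OF imageI[OF that]]] by (simp add: orthogonal_def)
      then show ?thesis
        using x(1) True
        by (intro that[of "(1 / norm x) *\<^sub>R x"])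
          (auto simp: power2_norm_eq_inner[symmetric] power2_eq_square inner_commute)
    qed
    have "p \<bullet> (\<Sum>i\<in>S. (q i \<bullet> w k) *\<^sub>R q i) = 0"
      unfolding inner_sum_right using p(2) by (intro sum.neutral) (simp add: inner_commute)
    then have pr: "p \<bullet> w k = p \<bullet> r"
      by (simp add: r_def inner_diff_right)
    have "w k = r + (\<Sum>i\<in>S. (q i \<bullet> w k) *\<^sub>R q i)"
      by (simp add: r_def)
    also have "r = (p \<bullet> w k) *\<^sub>R p"
      unfolding pr by (rule p(3))
    finally have wk: "w k = (p \<bullet> w k) *\<^sub>R p + (\<Sum>i\<in>S. (q i \<bullet> w k) *\<^sub>R q i)" .
    let ?q = "q(k := p)"
    have "{i \<in> insert k S. i \<le> k} = insert k S"
      using insert.hyps by (auto simp: less_imp_le)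
    moreover have "(\<Sum>i\<in>insert k S. (?q i \<bullet> w k) *\<^sub>R ?q i) = w k"
    proof -
      have "(\<Sum>i\<in>S. (?q i \<bullet> w k) *\<^sub>R ?q i) = (\<Sum>i\<in>S. (q i \<bullet> w k) *\<^sub>R q i)"
        using k by (intro sum.cong) auto
      then show ?thesis
        by (subst (2) wk) (simp only: sum.insert[OF finite k] fun_upd_same)
    qed
    ultimately have "w k = (\<Sum>i\<in>{i\<in>insert k S. i \<le> k}. (?q i \<bullet> w k) *\<^sub>R ?q i)"
      by simp
    moreover have "w j = (\<Sum>i\<in>{i\<in>insert k S. i \<le> j}. (?q i \<bullet> w j) *\<^sub>R ?q i)" if "j \<in> S" for j
    proof -
      have "\<not> k \<le> j"
        using insert.hyps(2) that by (simp add: not_le)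
      then have "{i \<in> insert k S. i \<le> j} = {i \<in> S. i \<le> j}"
        by blast
      moreover have "(\<Sum>i\<in>{i\<in>S. i \<le> j}. (?q i \<bullet> w j) *\<^sub>R ?q i)
          = (\<Sum>i\<in>{i\<in>S. i \<le> j}. (q i \<bullet> w j) *\<^sub>R q i)"
        using k by (intro sum.cong) auto
      ultimately show ?thesis
        by (simp only: w[OF that, symmetric])
    qed
    moreover have "\<forall>i\<in>insert k S. \<forall>j\<in>insert k S. ?q i \<bullet> ?q j = (if i = j then 1 else 0)"
      using k q p(1,2) by (auto simp: inner_commute)
    ultimately show ?case
      by (intro exI[of _ ?q]) (simp only: ball_simps, blast)
  qed auto
  from this[of UNIV] obtain q :: "'p \<Rightarrow> (real, 'n) vec"
    where *: "(\<forall>i\<in>UNIV. \<forall>j\<in>UNIV. q i \<bullet> q j = (if i = j then 1 else 0)) \<and>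
      (\<forall>j\<in>UNIV. w j = (\<Sum>i\<in>{i\<in>UNIV. i \<le> j}. (q i \<bullet> w j) *\<^sub>R q i))"
    by (rule exE)
  have q: "q i \<bullet> q j = (if i = j then 1 else 0)" for i j
    using * by blast
  have w: "(\<Sum>i\<in>{i. i \<le> j}. (q i \<bullet> w j) *\<^sub>R q i) = w j" for j
    using conjunct2[OF *, THEN bspec, of j] by simp
  define Q :: "((real, 'p) vec, 'n) vec" where "Q = (\<chi> r c. q c $ r)"
  define R :: "((real, 'p) vec, 'p) vec" where "R = (\<chi> i j. if i \<le> j then q i \<bullet> w j else 0)"
  have "(transpose Q ** Q) $ i $ j = q i \<bullet> q j" for i j
    by (simp add: Q_def matrix_matrix_mult_def transpose_def inner_vec_def)
  then have "Q \<in> stiefel"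
    by (simp add: stiefel_def vec_eq_iff q mat_def)
  moreover have "upper_triangular R"
    by (auto simp: upper_triangular_def R_def)
  moreover have "(Q ** R) $ r $ j = W $ r $ j" for r j
  proof -
    have "(Q ** R) $ r $ j = (\<Sum>i\<in>UNIV. if i \<le> j then (q i \<bullet> w j) * q i $ r else 0)"
      by (auto simp: Q_def R_def matrix_matrix_mult_def intro!: sum.cong)
    also have "\<dots> = (\<Sum>i\<in>{i. i \<le> j}. (q i \<bullet> w j) *\<^sub>R q i) $ r"
      by (simp add: sum.If_cases)
    also have "\<dots> = W $ r $ j"
      unfolding w by (simp add: w_def column_def)
    finally show ?thesis .
  qed
  ultimately have "thin_qr W Q R"
    by (simp add: thin_qr_def vec_eq_iff)
  then show ?thesis by blast
qed

section \<open>Algebra of two-by-two block matrices\<close>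

lemma sum_UNIV_Plus:
  "(\<Sum>i\<in>(UNIV :: ('a::finite + 'b::finite) set). f i) = (\<Sum>a\<in>UNIV. f (Inl a)) + (\<Sum>b\<in>UNIV. f (Inr b))"
  by (simp add: UNIV_Plus_UNIV[symmetric] sum.Plus del: UNIV_Plus_UNIV)

lemma block_eq_iff:
  "block P X N Y = block P' X' N' Y' \<longleftrightarrow> P = P' \<and> X = X' \<and> N = N' \<and> Y = Y'"
  by (auto simp: block_def vec_eq_iff split: sum.splits)

lemma transpose_block:
  "transpose (block P X N Y) = block (transpose P) (transpose N) (transpose X) (transpose Y)"
  by (simp add: block_def transpose_def vec_eq_iff split: sum.splits)

lemma uminus_block: "- block P X N Y = block (- P) (- X) (- N) (- Y)"
  by (simp add: block_def vec_eq_iff split: sum.splits)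

lemma block_mult_block:
  "block P X N Y ** block P' X' N' Y' =
    block (P ** P' + X ** N') (P ** X' + X ** Y') (N ** P' + Y ** N') (N ** X' + Y ** Y')"
  by (simp add: block_def matrix_matrix_mult_def vec_eq_iff sum_UNIV_Plus split: sum.splits)

lemma mat_1_block: "mat 1 = block (mat 1) 0 0 (mat 1)"
  by (auto simp: block_def mat_def vec_eq_iff split: sum.splits)

lemma top_block_mult: "top_block (block P X N Y ** W) = P ** top_block W + X ** bottom_block W"
  and bottom_block_mult: "bottom_block (block P X N Y ** W) = N ** top_block W + Y ** bottom_block W"
  by (simp_all add: block_def top_block_def bottom_block_def matrix_matrix_mult_def vec_eq_iff
      sum_UNIV_Plus)

lemma top_block_stack_id_zero: "top_block stack_id_zero = mat 1"
  and bottom_block_stack_id_zero: "bottom_block stack_id_zero = 0"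
  by (simp_all add: top_block_def bottom_block_def stack_id_zero_def mat_def vec_eq_iff)

text \<open>Changing the second block column by \<open>\<Phi>\<close> is right multiplication by the
  orthogonal matrix diag(I, \<Phi>).\<close>

lemma orthogonal_block_mult_right:
  assumes "orthogonal_mat (block M X N Y)" "orthogonal_mat \<Phi>"
  shows "transpose (block M (X ** \<Phi>) N (Y ** \<Phi>)) ** block M (X ** \<Phi>) N (Y ** \<Phi>) = mat 1"
proof -
  define V where "V = block M X N Y"
  define D where "D = block (mat 1) 0 0 \<Phi>"
  have "block M (X ** \<Phi>) N (Y ** \<Phi>) = V ** D"
    by (simp add: V_def D_def block_mult_block matmul.zero_left matmul.zero_right)
  moreover have "transpose (V ** D) ** (V ** D) = transpose D ** (transpose V ** V) ** D"
    by (simp add: matrix_transpose_mul matrix_mul_assoc)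
  moreover have "transpose V ** V = mat 1"
    using assms(1) by (simp add: orthogonal_mat_def V_def)
  moreover have "transpose D ** D = mat 1"
    using assms(2)
    by (simp add: D_def transpose_block block_mult_block matmul.zero_left matmul.zero_right
        orthogonal_mat_def mat_1_block[symmetric] transpose_def[of 0] zero_vec_def[symmetric])
  ultimately show ?thesis by simp
qed

text \<open>The curve \<open>t \<mapsto> exp (t L) (0, w)\<close> starts with velocity \<open>(- B\<^sup>T w, 0)\<close>; if
  \<open>N\<^sup>T w = 0\<close> it has no displacement in that direction at time \<open>-1\<close>, which is impossible
  when \<open>L\<close> has norm below \<open>\<pi>\<close>.\<close>
lemma null_bottom_left_block:
  fixes A B M X N Y :: "real^'p^'p"
  assumes log: "mexp (block A (- transpose B) B 0) = block M X N Y"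
    and skew: "transpose A = - A"
    and strip: "\<And>\<mu>. is_eigenvalue (block A (- transpose B) B 0) \<mu> \<Longrightarrow> Im \<mu> < pi"
    and w: "transpose N *v w = 0"
  shows "transpose B *v w = 0"
proof (rule ccontr)
  assume nz: "transpose B *v w \<noteq> 0"
  define L where "L = block A (- transpose B) B 0"
  have L: "transpose L = - L"
    by (simp add: L_def transpose_block uminus_block skew transpose_minus block_eq_iff
        transpose_def[of 0] zero_vec_def[symmetric])
  obtain \<theta> where \<theta>: "0 < \<theta>" "\<theta> < pi" "\<And>y. norm (L *v y) \<le> \<theta> * norm y"
    using skew_norm_less_pi[OF L, of "mat 1" L] strip
    by (auto simp: L_def invertible_def)
  define W :: "real^('p+'p)" where "W = (\<chi> i. case i of Inl a \<Rightarrow> 0 | Inr a \<Rightarrow> w $ a)"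
  define z where "z = L *v W"
  have z: "z $ Inl a = - (transpose B *v w) $ a" "z $ Inr a = 0" for a
    by (simp_all add: z_def L_def W_def block_def matrix_vector_mult_def sum_UNIV_Plus
        sum_negf)
  have "z \<noteq> 0"
    using nz z(1) by (metis neg_equal_0_iff_equal vec_eq_iff zero_index)
  define F where "F t = mexp (t *\<^sub>R L)" for t
  have lin: "bounded_linear (\<lambda>M :: real^('p+'p)^('p+'p). M *v x)" for x
    unfolding linear_conv_bounded_linear[symmetric]
    by (intro linearI) (auto simp: matrix_vector_mult_add_rdistrib scaleR_matrix_vector_assoc[symmetric])
  have dF: "((\<lambda>t. F t *v x) has_vector_derivative L *v (F t *v x)) (at t)" for x t
    using bounded_linear.has_vector_derivative[OF lin[of x] mexp_has_vector_derivative[of L]]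
    by (simp add: F_def matrix_vector_mul_assoc)
  have dy: "((\<lambda>t. F t *v W) has_vector_derivative F t *v z) (at t)" for t
    using dF[of W t] by (simp add: z_def matrix_vector_mul_assoc F_def mexp_commute)
  have F0: "F 0 = mat 1" by (simp add: F_def mexp_0)
  have "(F 0 *v z) \<bullet> (F (- 1) *v W) < (F 0 *v z) \<bullet> (F 0 *v W)"
    by (rule displacement_pos_backward[OF dy dF skew_inner_self[OF L] \<theta>(3) zero_less_one])
      (use \<theta> \<open>z \<noteq> 0\<close> F0 in auto)
  \<comment> \<open>Skewness of \<open>L\<close> turns the backward flow into a transpose, whose
    upper part on (0, w) involves only \<open>N\<close>. As the lower half of \<open>z\<close>
    vanishes, \<open>z\<close> is orthogonal to the curve at both times -1 and 0.\<close>
  moreover have "F (- 1) = transpose (block M X N Y)"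
    by (simp add: F_def log[symmetric] L_def[symmetric] transpose_mexp L)
  moreover have "z \<bullet> W = 0"
    by (simp add: inner_vec_def sum_UNIV_Plus z W_def)
  moreover have "z \<bullet> (transpose (block M X N Y) *v W) = 0"
  proof -
    have "(transpose (block M X N Y) *v W) $ Inl a = (transpose N *v w) $ a" for a
      unfolding transpose_block by (simp add: block_def W_def matrix_vector_mult_def sum_UNIV_Plus)
    then show ?thesis
      using w by (simp add: inner_vec_def sum_UNIV_Plus z)
  qed
  ultimately show False by (simp add: F0)
qed

lemma bounded_linear_top_block: "bounded_linear (top_block :: real^'p^('p+'p) \<Rightarrow> real^'p^'p)"
  and bounded_linear_bottom_block: "bounded_linear (bottom_block :: real^'p^('p+'p) \<Rightarrow> real^'p^'p)"
  unfolding linear_conv_bounded_linear[symmetric]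
  by (auto intro!: linearI simp: top_block_def bottom_block_def vec_eq_iff)

text \<open>The formula for the Riemannian exponential does not depend on the QR decomposition chosen,
  even when the columns of \<open>Q\<close> are not orthogonal to those of \<open>U\<close>.\<close>
lemma mexp_block_factorization_independent:
  fixes Q Q' :: "real^'p^'n" and A B R :: "real^'p^'p"
  assumes st: "Q \<in> stiefel" "Q' \<in> stiefel" and eq: "Q ** B = Q' ** R"
  defines "E \<equiv> mexp (block A (- transpose B) B 0) ** stack_id_zero"
    and "E' \<equiv> mexp (block A (- transpose R) R 0) ** stack_id_zero"
  shows "top_block E = top_block E'" and "Q ** bottom_block E = Q' ** bottom_block E'"
proof -
  define L where "L = block A (- transpose B) B 0"
  define L' where "L' = block A (- transpose R) R 0"
  \<comment> \<open>The bottom blocks themselves may differ; only their images under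
    \<open>Q\<close> and \<open>Q'\<close> agree. This suffices for the induction, because
    orthonormal columns let the product of the transpose of \<open>B\<close> with a bottom block be
    computed from \<open>Q ** B\<close> and that image.\<close>
  have pow: "top_block (matpow L k ** stack_id_zero) = top_block (matpow L' k ** stack_id_zero) \<and>
      Q ** bottom_block (matpow L k ** stack_id_zero) = Q' ** bottom_block (matpow L' k ** stack_id_zero)"
    for k
  proof (induction k)
    case 0
    show ?case by (simp add: bottom_block_stack_id_zero matmul.zero_right)
  next
    case (Suc k)
    let ?S = "matpow L k ** stack_id_zero" and ?S' = "matpow L' k ** stack_id_zero"
    have "transpose B ** bottom_block ?S = transpose (Q ** B) ** (Q ** bottom_block ?S)"
    proof -
      have "transpose (Q ** B) ** (Q ** bottom_block ?S)
          = transpose B ** (transpose Q ** Q) ** bottom_block ?S"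
        by (simp add: matrix_transpose_mul matrix_mul_assoc)
      then show ?thesis using st by (simp add: stiefel_def)
    qed
    also have "\<dots> = transpose (Q' ** R) ** (Q' ** bottom_block ?S')"
      using Suc eq by simp
    also have "\<dots> = transpose R ** (transpose Q' ** Q') ** bottom_block ?S'"
      by (simp add: matrix_transpose_mul matrix_mul_assoc)
    also have "\<dots> = transpose R ** bottom_block ?S'"
      using st by (simp add: stiefel_def)
    finally have "transpose B ** bottom_block ?S = transpose R ** bottom_block ?S'" .
    moreover have "matpow L (Suc k) ** stack_id_zero = L ** ?S"
      "matpow L' (Suc k) ** stack_id_zero = L' ** ?S'"
      by (simp_all add: matrix_mul_assoc)
    moreover have "Q ** (B ** top_block ?S) = Q' ** (R ** top_block ?S')"
      using Suc eq by (simp add: matrix_mul_assoc)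
    ultimately show ?case
      using Suc
      by (simp add: L_def L'_def top_block_mult bottom_block_mult matmul.minus_left
          matmul.zero_left del: matpow.simps)
  qed
  have sums: "(\<lambda>k. (1 / fact k) *\<^sub>R f (matpow K k ** stack_id_zero)) sums f (mexp K ** stack_id_zero)"
    if "bounded_linear f" for f :: "real^'p^('p+'p) \<Rightarrow> 'b::real_normed_vector" and K
    using bounded_linear.sums[OF that bounded_linear.sums[OF matmul.bounded_linear_left mexp_sums]]
    by (simp add: matmul.scaleR_left linear_scale[OF bounded_linear.linear[OF that]])
  show "top_block E = top_block E'"
    using sums[OF bounded_linear_top_block, of L] sums[OF bounded_linear_top_block, of L'] pow
    unfolding E_def E'_def L_def[symmetric] L'_def[symmetric] by (simp add: sums_unique2)
  have "bounded_linear (\<lambda>S. P ** bottom_block S)" for P :: "real^'p^'n"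
    using bounded_linear_compose[OF matmul.bounded_linear_right bounded_linear_bottom_block] .
  from sums[OF this[of Q], of L] sums[OF this[of Q'], of L'] pow
  show "Q ** bottom_block E = Q' ** bottom_block E'"
    unfolding E_def E'_def L_def[symmetric] L'_def[symmetric] by (simp add: sums_unique2)
qed

section \<open>The Riemannian exponential of U A + Q B\<close>

theorem theorem3p1:
  fixes U Ut Q :: "((real, 'p::{finite,linorder}) vec, 'n::finite) vec"
    and N X0 Y0 Phi A B :: "((real, 'p) vec, 'p) vec"
  assumes "CARD('p) \<le> CARD('n)"
    and "U \<in> stiefel" and "Ut \<in> stiefel"
    and "thin_qr ((mat 1 - U ** transpose U) ** Ut) Q N"
    and "orthogonal_mat (block (transpose U ** Ut) X0 N Y0)"
    and "orthogonal_mat Phi"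
    and "principal_log (block (transpose U ** Ut) (X0 ** Phi) N (Y0 ** Phi))
                       (block A (- transpose B) B 0)"
  shows "U ** A + Q ** B \<in> tangent_stiefel U \<and> stiefel_exp U (U ** A + Q ** B) = Ut"
proof -
  define L where "L = block A (- transpose B) B 0"
  define D where "D = U ** A + Q ** B"
  have UU: "transpose U ** U = mat 1"
    using assms(2) by (simp add: stiefel_def)
  have Q: "Q \<in> stiefel" and QN: "Q ** N = (mat 1 - U ** transpose U) ** Ut"
    using assms(4) by (auto simp: thin_qr_def)
  have log: "mexp L = block (transpose U ** Ut) (X0 ** Phi) N (Y0 ** Phi)"
    and strip: "\<And>\<mu>. is_eigenvalue L \<mu> \<Longrightarrow> Im \<mu> < pi"
    using assms(7) by (auto simp: principal_log_def L_def)
  have "transpose (mexp L) ** mexp L = mat 1"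
    unfolding log by (rule orthogonal_block_mult_right[OF assms(5,6)])
  then have "transpose L = - L"
    using strip by (rule skew_of_principal_log)
  then have A: "transpose A = - A"
    by (simp add: L_def transpose_block uminus_block block_eq_iff)
  have proj: "transpose U ** ((mat 1 - U ** transpose U) ** C) = 0" for C :: "((real, 'p) vec, 'n) vec"
  proof -
    have "transpose U ** ((mat 1 - U ** transpose U) ** C)
        = transpose U ** C - (transpose U ** U) ** (transpose U ** C)"
      by (simp add: matmul.diff_left matmul.diff_right matrix_mul_assoc)
    then show ?thesis by (simp add: UU)
  qed
  \<comment> \<open>The transpose of \<open>N\<close> annihilates the range of
    \<open>transpose Q ** U\<close>; the transpose of \<open>B\<close> then does so too.\<close>
  have "transpose N ** (transpose Q ** U) = transpose (transpose U ** (Q ** N))"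
    by (simp add: matrix_transpose_mul matrix_mul_assoc)
  also have "\<dots> = 0"
    unfolding QN proj by (simp add: transpose_def zero_vec_def)
  finally have "transpose N *v ((transpose Q ** U) *v x) = 0" for x
    by (simp add: matrix_vector_mul_assoc)
  then have "transpose B *v ((transpose Q ** U) *v x) = 0" for x
    using null_bottom_left_block[OF log[unfolded L_def] A] strip unfolding L_def by blast
  then have BQU: "transpose (Q ** B) ** U = 0"
    by (simp add: matrix_eq matrix_vector_mul_assoc matrix_transpose_mul matrix_mul_assoc)
  have "transpose U ** (Q ** B) = transpose (transpose (Q ** B) ** U)"
    by (simp add: matrix_transpose_mul)
  then have UQB: "transpose U ** (Q ** B) = 0"
    unfolding BQU by (simp add: transpose_def zero_vec_def)
  have UD: "transpose U ** D = A"
    by (simp add: D_def matmul.add_right UQB matrix_mul_assoc UU)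
       (simp add: matrix_mul_assoc[symmetric] UQB)
  have "transpose D ** U = transpose A ** (transpose U ** U) + transpose (Q ** B) ** U"
    by (simp add: D_def transpose_add matmul.add_left matrix_transpose_mul matrix_mul_assoc)
  then have "transpose D ** U = - A"
    by (simp add: UU BQU A)
  then have tangent: "D \<in> tangent_stiefel U"
    by (simp add: tangent_stiefel_def UD)
  have "(mat 1 - U ** transpose U) ** D = D - U ** (transpose U ** D)"
    by (simp add: matmul.diff_left matrix_mul_assoc)
  then have W: "(mat 1 - U ** transpose U) ** D = Q ** B"
    by (simp add: UD) (simp add: D_def)
  \<comment> \<open>The factors chosen inside \<open>stiefel_exp\<close>. They may differ from
    \<open>Q\<close> and \<open>B\<close>, since \<open>B\<close> need not be triangular.\<close>
  define QR where "QR = (SOME QR. thin_qr (Q ** B) (fst QR) (snd QR))"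
  have "\<exists>QR. thin_qr (Q ** B) (fst QR) (snd QR)"
    using thin_qr_exists[OF assms(1), of "Q ** B"] by auto
  then have QR: "fst QR \<in> stiefel" "Q ** B = fst QR ** snd QR"
    unfolding QR_def by (metis (mono_tags, lifting) someI_ex thin_qr_def)+
  have "stiefel_exp U D = U ** top_block (mexp L ** stack_id_zero) + Q ** bottom_block (mexp L ** stack_id_zero)"
    unfolding stiefel_exp_def Let_def UD W QR_def[symmetric] L_def
    by (simp add: mexp_block_factorization_independent[OF Q QR])
  \<comment> \<open>\<open>stack_id_zero\<close> selects the first block column of
    \<open>mexp L\<close>, which is free of \<open>Phi\<close>.\<close>
  also have "\<dots> = U ** (transpose U ** Ut) + Q ** N"
    by (simp add: log top_block_mult bottom_block_mult top_block_stack_id_zero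
        bottom_block_stack_id_zero matmul.zero_right)
  also have "\<dots> = Ut"
    by (simp add: QN matmul.diff_left matrix_mul_assoc)
  finally show ?thesis
    using tangent by (simp add: D_def)
qed

end
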